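(* For any prime number $p\geq 3$, there exists a configuration of $p^2$ lines in the complex projective plane intersecting in $\frac{(p^2-2)(p^2-1)}{6}$ triple points (and $p^2-1$ double points).
   Context: A configuration of lines is a finite set of mutually distinct lines in a projective plane. A double (respectively triple) point of a configuration is a point where exactly two (respectively exactly three) lines of the configuration meet.
   Formalization: The case p = 3 is excluded, so the result is proved for all primes p ≥ 5; for p = 3 the claimed number of triple points, (9−2)(9−1)/6 = 28/3, is not an integer, so the claim fails there. *)

theory Defs
  imports "HOL-Analysis.Analysis" "HOL-Computational_Algebra.Primes"
begin

text \<open>
  The projective plane over a field: a point is a one-dimensional linear subspace of the
  coordinate space of dimension 3, and a line is the set of all points contained in a given
  two-dimensional subspace.  Subspaces, span and dimension are those over the field itself
  (the \<open>vec\<close> interpretation for \<open>*s\<close>), not the real ones.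
\<close>

definition proj_points :: "('a::field ^ 3) set set" where
  "proj_points = {P. vec.subspace P \<and> vec.dim P = 1}"

definition proj_lines :: "('a::field ^ 3) set set set" where
  "proj_lines = {{P \<in> proj_points. P \<subseteq> W} | W. vec.subspace W \<and> vec.dim W = 2}"

definition line_configuration :: "('a::field ^ 3) set set set \<Rightarrow> bool" where
  "line_configuration L \<longleftrightarrow> finite L \<and> L \<subseteq> proj_lines"

definition points_of_multiplicity ::
    "nat \<Rightarrow> ('a::field ^ 3) set set set \<Rightarrow> ('a ^ 3) set set" where
  "points_of_multiplicity k L = {P \<in> proj_points. card {l \<in> L. P \<in> l} = k}"

abbreviation double_points :: "('a::field ^ 3) set set set \<Rightarrow> ('a ^ 3) set set" where
  "double_points \<equiv> points_of_multiplicity 2"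

abbreviation triple_points :: "('a::field ^ 3) set set set \<Rightarrow> ('a ^ 3) set set" where
  "triple_points \<equiv> points_of_multiplicity 3"

text \<open>
  The number \<open>(p\<^sup>2 - 2) (p\<^sup>2 - 1) / 6\<close> is an integer for every prime \<open>p\<close> except 3,
  where it is 28/3; a configuration with that many triple points is therefore only possible
  for \<open>p \<noteq> 3\<close>.
\<close>

lemma no_triple_point_count_for_3:
  "real n \<noteq> ((real 3)\<^sup>2 - 2) * ((real 3)\<^sup>2 - 1) / 6"
proof
  assume "real n = ((real 3)\<^sup>2 - 2) * ((real 3)\<^sup>2 - 1) / 6"
  then have "real (3 * n) = real 28" by simp
  then have "3 * n = 28" by (simp only: of_nat_eq_iff)
  then show False by presburger
qed

end

theory Submission
  imports Defs
begin

text \<open>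
  The points \<open>(t : t\<^sup>2 : t\<^sup>3 - 1)\<close>, with \<open>t \<noteq> 0\<close>, are the smooth points of a nodal cubic, and
  three of them are collinear exactly when the product of their parameters is \<open>1\<close>: the collinearity
  law of the cubic is that of the multiplicative group.  Dually, the lines
  \<open>t x + t\<^sup>2 y + (t\<^sup>3 - 1) z = 0\<close> through a given point are given by the roots of a polynomial
  \<open>z t\<^sup>3 + y t\<^sup>2 + x t - z\<close>, whose roots, if \<open>z \<noteq> 0\<close>, have product \<open>1\<close>.

  Take \<open>t\<close> in the group \<open>R\<close> of \<open>n\<close>-th roots of unity, with \<open>n\<close> coprime to 3.  If the lines of
  \<open>a \<noteq> b\<close> meet in \<open>P\<close>, then the third root \<open>1 / (a b)\<close> again lies in \<open>R\<close>, so the lines through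
  \<open>P\<close> are exactly those of \<open>a\<close>, \<open>b\<close> and \<open>1 / (a b)\<close> (\<open>eq_meet\<close>, \<open>roots_through_meet\<close>).  Hence
  every intersection point is double or triple.  It is double when the polynomial has a repeated
  root \<open>t\<close>, the other root being \<open>1 / t\<^sup>2 \<noteq> t\<close>; since \<open>R\<close> has no element of order 3, this happens
  once for each \<open>t \<noteq> 1\<close> in \<open>R\<close>, so there are \<open>n - 1\<close> double points (\<open>card_double_points\<close>).
  Two lines meet once, so counting pairs of lines by their intersection points gives
  \<open>3 T + (n - 1) = n (n - 1) / 2\<close> for the number \<open>T\<close> of triple points (\<open>pairs_of_lines_count\<close>), that
  is, \<open>T = (n - 1) (n - 2) / 6\<close>.  The theorem is the case \<open>n = p\<^sup>2\<close>.
\<close>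

section \<open>Lines dual to a nodal cubic\<close>

definition cubic_form :: "complex ^ 3 \<Rightarrow> complex \<Rightarrow> complex" where
  "cubic_form u t = u $ 1 * t + u $ 2 * t\<^sup>2 + u $ 3 * (t ^ 3 - 1)"

definition cubic_line :: "complex \<Rightarrow> (complex ^ 3) set set" where
  "cubic_line t = {P \<in> proj_points. P \<subseteq> {u. cubic_form u t = 0}}"

text \<open>
  These coordinates are read off by expanding \<open>(t - a) (t - b) (t - 1 / (a b))\<close> in the basis
  \<open>t\<close>, \<open>t\<^sup>2\<close>, \<open>t\<^sup>3 - 1\<close>.  The case \<open>a = b\<close> is meaningful: it is the point at which \<open>a\<close> becomes a
  double root.
\<close>
definition meet_vec :: "complex \<Rightarrow> complex \<Rightarrow> complex ^ 3" where
  "meet_vec a b = vector [a * b + 1 / a + 1 / b, - (a + b + 1 / (a * b)), 1]"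

definition meet :: "complex \<Rightarrow> complex \<Rightarrow> (complex ^ 3) set" where
  "meet a b = vec.span {meet_vec a b}"

definition roots_through :: "nat \<Rightarrow> (complex ^ 3) set \<Rightarrow> complex set" where
  "roots_through n P = {t. t ^ n = 1 \<and> P \<in> cubic_line t}"

lemma subspace_cubic_form_kernel: "vec.subspace {u. cubic_form u t = 0}"
  unfolding vec.subspace_def
proof (intro conjI ballI allI)
  fix x y assume "x \<in> {u. cubic_form u t = 0}" "y \<in> {u. cubic_form u t = 0}"
  moreover have "cubic_form (x + y) t = cubic_form x t + cubic_form y t"
    by (simp add: cubic_form_def algebra_simps)
  ultimately show "x + y \<in> {u. cubic_form u t = 0}" by simp
next
  fix c x assume "x \<in> {u. cubic_form u t = 0}"
  moreover have "cubic_form (c *s x) t = c * cubic_form x t"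
    by (simp add: cubic_form_def algebra_simps)
  ultimately show "c *s x \<in> {u. cubic_form u t = 0}" by simp
qed (simp add: cubic_form_def)

lemma dim_cubic_form_kernel:
  assumes "t \<noteq> 0"
  shows "vec.dim {u. cubic_form u t = 0} = 2"
proof -
  define e :: "complex ^ 3" where "e = vector [- t, 1, 0]"
  define f :: "complex ^ 3" where "f = vector [- (t ^ 3 - 1) / t, 0, 1]"
  have ef [simp]: "e $ 1 = - t" "e $ 2 = 1" "e $ 3 = 0"
    "f $ 1 = - (t ^ 3 - 1) / t" "f $ 2 = 0" "f $ 3 = 1"
    by (simp_all add: e_def f_def)
  have "e \<noteq> f" by (metis ef(3,6) zero_neq_one)
  have "e \<notin> vec.span {f}"
  proof
    assume "e \<in> vec.span {f}"
    then obtain k where "e = k *s f" by (auto simp: vec.span_singleton)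
    then have "e $ 2 = k * f $ 2" by simp
    then show False by simp
  qed
  moreover have "f \<noteq> 0" by (metis ef(6) zero_index zero_neq_one)
  ultimately have indep: "vec.independent {e, f}"
    using \<open>e \<noteq> f\<close> by (simp add: vec.independent_insert)
  have "{u. cubic_form u t = 0} \<subseteq> vec.span {e, f}"
  proof
    fix u assume "u \<in> {u. cubic_form u t = 0}"
    then have "u $ 1 * t = - (u $ 2 * t\<^sup>2 + u $ 3 * (t ^ 3 - 1))"
      unfolding cubic_form_def mem_Collect_eq by algebra
    then have "u $ 1 = - (u $ 2 * t\<^sup>2 + u $ 3 * (t ^ 3 - 1)) / t"
      using assms by (simp add: nonzero_eq_divide_eq)
    then have "u $ 1 = u $ 2 * (- t) + u $ 3 * (- (t ^ 3 - 1) / t)"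
      using assms by (simp add: field_simps power2_eq_square)
    then have "u = u $ 2 *s e + u $ 3 *s f"
      by (simp add: vec_eq_iff forall_3)
    then show "u \<in> vec.span {e, f}"
      by (metis insertI1 insertI2 vec.span_add vec.span_base vec.span_scale)
  qed
  moreover have "{e, f} \<subseteq> {u. cubic_form u t = 0}"
    using assms by (simp add: cubic_form_def power2_eq_square)
  ultimately show ?thesis
    using indep \<open>e \<noteq> f\<close> by (intro vec.dim_unique[of "{e, f}"]) auto
qed

lemma cubic_line_in_proj_lines: "t \<noteq> 0 \<Longrightarrow> cubic_line t \<in> proj_lines"
  unfolding cubic_line_def proj_lines_def
  using subspace_cubic_form_kernel dim_cubic_form_kernel by blast

section \<open>Intersection points\<close>

lemma meet_vec_nth [simp]:
  "meet_vec a b $ 1 = a * b + 1 / a + 1 / b"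
  "meet_vec a b $ 2 = - (a + b + 1 / (a * b))"
  "meet_vec a b $ 3 = 1"
  by (simp_all add: meet_vec_def)

lemma meet_vec_nonzero: "meet_vec a b \<noteq> 0"
  by (metis meet_vec_nth(3) zero_index zero_neq_one)

lemma meet_in_proj_points: "meet a b \<in> proj_points"
  by (simp add: meet_def proj_points_def vec.dim_eq_card_independent meet_vec_nonzero)

lemma cubic_form_meet_vec:
  assumes "a \<noteq> 0" "b \<noteq> 0"
  shows "cubic_form (meet_vec a b) t = (t - a) * (t - b) * (t - 1 / (a * b))"
  using assms by (simp add: cubic_form_def field_simps power2_eq_square power3_eq_cube)

lemma meet_in_cubic_line_iff:
  assumes "a \<noteq> 0" "b \<noteq> 0"
  shows "meet a b \<in> cubic_line t \<longleftrightarrow> t \<in> {a, b, 1 / (a * b)}"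
proof -
  have "meet a b \<subseteq> {u. cubic_form u t = 0} \<longleftrightarrow> cubic_form (meet_vec a b) t = 0"
    unfolding meet_def
    using vec.span_minimal[OF _ subspace_cubic_form_kernel, of "{meet_vec a b}" t]
      vec.span_superset[of "{meet_vec a b}"] by auto
  then show ?thesis
    using meet_in_proj_points by (simp add: cubic_line_def cubic_form_meet_vec[OF assms])
qed

text \<open>
  This is where the group structure enters: the third root \<open>1 / (a b)\<close> stays among the \<open>n\<close>-th roots
  of unity, so it misses giving a third line only when it coincides with \<open>a\<close> or \<open>b\<close>.
\<close>
lemma roots_through_meet:
  assumes "n > 0" "a ^ n = 1" "b ^ n = 1"
  shows "roots_through n (meet a b) = {a, b, 1 / (a * b)}"
proof -
  have "a \<noteq> 0" "b \<noteq> 0" using assms by (auto simp: power_0_left)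
  then show ?thesis
    using assms
    by (auto simp: roots_through_def meet_in_cubic_line_iff power_divide power_mult_distrib)
qed

text \<open>
  For \<open>u\<close> spanning \<open>P\<close>, subtracting \<open>u $ 3\<close> times the form of \<open>meet_vec a b\<close> removes the cubic and
  constant terms, leaving \<open>t (\<alpha> + \<beta> t)\<close>; this vanishes at the distinct nonzero \<open>a\<close> and \<open>b\<close>, so it is
  zero and \<open>u\<close> is a multiple of \<open>meet_vec a b\<close>.
\<close>
lemma eq_meet:
  assumes "P \<in> cubic_line a" "P \<in> cubic_line b" "a \<noteq> b" "a \<noteq> 0" "b \<noteq> 0"
  shows "P = meet a b"
proof -
  have P: "vec.subspace P" "vec.dim P = 1"
    using assms(1) by (auto simp: cubic_line_def proj_points_def)
  have "\<not> P \<subseteq> {0}" using P(2) by (simp flip: vec.dim_eq_0)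
  then obtain u where u: "u \<in> P" "u \<noteq> 0" by blast
  have ua: "cubic_form u a = 0" and ub: "cubic_form u b = 0"
    using assms u by (auto simp: cubic_line_def)
  define \<alpha> where "\<alpha> = u $ 1 - u $ 3 * (a * b + 1 / a + 1 / b)"
  define \<beta> where "\<beta> = u $ 2 + u $ 3 * (a + b + 1 / (a * b))"
  have h: "t * (\<alpha> + \<beta> * t) = cubic_form u t - u $ 3 * cubic_form (meet_vec a b) t" for t
    by (simp add: \<alpha>_def \<beta>_def cubic_form_def algebra_simps power2_eq_square)
  have "\<alpha> + \<beta> * a = 0" "\<alpha> + \<beta> * b = 0"
    using h[of a] h[of b] ua ub assms(4,5) by (simp_all add: cubic_form_meet_vec)
  then have "\<beta> * (a - b) = 0" by algebra
  with assms(3) have "\<beta> = 0" by simp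
  with \<open>\<alpha> + \<beta> * a = 0\<close> have "\<alpha> = 0" by simp
  have "u $ 1 = u $ 3 * (a * b + 1 / a + 1 / b)"
    using \<open>\<alpha> = 0\<close> by (simp add: \<alpha>_def)
  moreover have "u $ 2 = - (u $ 3 * (a + b + 1 / (a * b)))"
    using \<open>\<beta> = 0\<close> by (simp only: \<beta>_def eq_neg_iff_add_eq_0)
  ultimately have uz: "u = u $ 3 *s meet_vec a b"
    by (simp add: vec_eq_iff forall_3 algebra_simps)
  with u(2) have "u $ 3 \<noteq> 0" by auto
  then have "meet_vec a b = (1 / u $ 3) *s (u $ 3 *s meet_vec a b)"
    by (simp add: vector_smult_assoc)
  then have "meet_vec a b = (1 / u $ 3) *s u"
    by (simp flip: uz)
  with u(1) P(1) have "meet_vec a b \<in> P" by (simp add: vec.subspace_scale)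
  then have sub: "meet a b \<subseteq> P"
    unfolding meet_def using P(1) by (intro vec.span_minimal) auto
  have "vec.subspace (meet a b)" "vec.dim (meet a b) = 1"
    using meet_in_proj_points[of a b] by (auto simp: proj_points_def)
  then show ?thesis
    using vec.subspace_dim_equal[OF _ P(1) sub] P(2) by simp
qed

text \<open>
  If the lines of \<open>a \<noteq> b\<close> coincided, their only point would be \<open>meet a b\<close>, which only the lines of
  \<open>a\<close>, \<open>b\<close> and \<open>1 / (a b)\<close> contain; but the line of \<open>a\<close> meets that of any further \<open>c\<close>.
\<close>
lemma inj_on_cubic_line: "inj_on cubic_line (- {0})"
proof (rule inj_onI, rule ccontr)
  fix a b :: complex
  assume *: "a \<in> - {0}" "b \<in> - {0}" "cubic_line a = cubic_line b" "a \<noteq> b"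
  have "cubic_line a = {meet a b}"
    using * eq_meet[of _ a b] meet_in_cubic_line_iff[of a b] by auto
  moreover obtain c where c: "c \<notin> {0, a, b, 1 / (a * b)}"
    using ex_new_if_finite[OF infinite_UNIV_char_0, of "{0, a, b, 1 / (a * b)}"] by blast
  have ac: "a \<noteq> 0" "c \<noteq> 0" using *(1) c by auto
  have "meet a c \<in> cubic_line a"
    using meet_in_cubic_line_iff[OF ac] by simp
  ultimately have "meet a c = meet a b" by simp
  then have "meet a b \<in> cubic_line c"
    using meet_in_cubic_line_iff[OF ac, of c] by simp
  then show False using *(1,2) c meet_in_cubic_line_iff[of a b c] by simp
qed

section \<open>The configuration of the roots of unity\<close>

lemma root_of_unity_cube_eq_1:
  assumes "coprime n 3" "t ^ n = 1" "t ^ 3 = (1 :: complex)"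
  shows "t = 1"
proof -
  have "n > 0" using assms(1) by (cases n) auto
  obtain x y where "n * x = 3 * y + 1"
    using bezout_nat[of n 3] assms(1) \<open>n > 0\<close> by auto
  then have "(t ^ n) ^ x = (t ^ 3) ^ y * t"
    by (metis power_add power_mult power_one_right)
  with assms show ?thesis by simp
qed

context
  fixes n :: nat and R :: "complex set" and L :: "(complex ^ 3) set set set"
  assumes n: "n > 0" "coprime n 3"
  defines "R \<equiv> {t. t ^ n = 1}" and "L \<equiv> cubic_line ` R"
begin

lemma finite_R: "finite R" and card_R: "card R = n"
  using n finite_roots_unity[of n] card_roots_unity_eq[of n] by (simp_all add: R_def)

lemma R_nonzero: "t \<in> R \<Longrightarrow> t \<noteq> 0"
  using n by (auto simp: R_def power_0_left)

lemma inj_on_cubic_line_R: "inj_on cubic_line R"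
  using inj_on_cubic_line by (rule inj_on_subset) (auto dest: R_nonzero)

lemma multiplicity_eq_card_roots:
  "card {l \<in> L. P \<in> l} = card (roots_through n P)"
proof -
  have "{l \<in> L. P \<in> l} = cubic_line ` roots_through n P"
    by (auto simp: L_def R_def roots_through_def)
  moreover have "inj_on cubic_line (roots_through n P)"
    using inj_on_cubic_line_R by (rule inj_on_subset) (auto simp: R_def roots_through_def)
  ultimately show ?thesis by (simp add: card_image)
qed

lemma points_of_multiplicity_roots:
  "points_of_multiplicity k L = {P \<in> proj_points. card (roots_through n P) = k}"
  by (simp add: points_of_multiplicity_def multiplicity_eq_card_roots)

lemma roots_through_subset: "roots_through n P \<subseteq> R"
  by (auto simp: roots_through_def R_def)

lemma roots_meet: "a \<in> R \<Longrightarrow> b \<in> R \<Longrightarrow> roots_through n (meet a b) = {a, b, 1 / (a * b)}"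
  using n by (simp add: R_def roots_through_meet)

lemma eq_meet_R:
  assumes "a \<in> roots_through n P" "b \<in> roots_through n P" "a \<noteq> b"
  shows "P = meet a b"
  using assms R_nonzero by (intro eq_meet) (auto simp: roots_through_def R_def)

lemma cube_ne_1: "t \<in> R - {1} \<Longrightarrow> t \<noteq> 1 / (t * t)"
proof
  assume t: "t \<in> R - {1}" and "t = 1 / (t * t)"
  then have "t ^ 3 = 1" using R_nonzero[of t] by (simp add: field_simps power3_eq_cube)
  with t n show False using root_of_unity_cube_eq_1[of n t] by (simp add: R_def)
qed

text \<open>
  At a double point with roots \<open>{a, b}\<close> the third root \<open>1 / (a b)\<close> repeats \<open>a\<close> or \<open>b\<close>; the repeated
  one is the \<open>t\<close> with \<open>P = meet t t\<close>.  The value \<open>t = 1\<close> is excluded because \<open>meet 1 1\<close> is the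
  point of the triple root, on a single line.
\<close>
lemma double_points_eq: "double_points L = (\<lambda>t. meet t t) ` (R - {1})"
proof (intro equalityI subsetI)
  fix P assume "P \<in> double_points L"
  then obtain a b where ab: "roots_through n P = {a, b}" "a \<noteq> b"
    by (auto simp: points_of_multiplicity_roots card_2_iff)
  then have R: "a \<in> R" "b \<in> R" using roots_through_subset[of P] by auto
  have P: "P = meet a b" using ab by (intro eq_meet_R) auto
  with ab roots_meet[OF R] have "1 / (a * b) \<in> {a, b}" by auto
  then obtain s where s: "s \<in> R" "P = meet s s"
  proof
    assume c: "1 / (a * b) = a"
    then have "1 / (a * a) = b" using R R_nonzero[of a] R_nonzero[of b]
      by (simp add: field_simps)
    then have "roots_through n (meet a a) = {a, b}" using R by (simp add: roots_meet)
    then have "meet a a = meet a b" using ab(2) by (intro eq_meet_R) auto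
    with P R that show ?thesis by metis
  next
    assume "1 / (a * b) \<in> {b}"
    then have c: "1 / (a * b) = b" by simp
    then have "1 / (b * b) = a" using R R_nonzero[of a] R_nonzero[of b]
      by (simp add: field_simps)
    then have "roots_through n (meet b b) = {a, b}" using R by (auto simp: roots_meet)
    then have "meet b b = meet a b" using ab(2) by (intro eq_meet_R) auto
    with P R that show ?thesis by metis
  qed
  have "s \<noteq> 1"
  proof
    assume "s = 1"
    then have "roots_through n P = {1}" using s roots_meet[of s s] by simp
    with ab show False by (metis insertI1 insertI2 singletonD)
  qed
  with s show "P \<in> (\<lambda>t. meet t t) ` (R - {1})" by blast
next
  fix P assume "P \<in> (\<lambda>t. meet t t) ` (R - {1})"
  then obtain t where "t \<in> R - {1}" "P = meet t t" by blast
  then show "P \<in> double_points L"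
    using cube_ne_1[of t]
    by (simp add: points_of_multiplicity_roots roots_meet meet_in_proj_points)
qed

lemma card_double_points: "card (double_points L) = n - 1"
proof -
  have "inj_on (\<lambda>t. meet t t) (R - {1})"
  proof (rule inj_onI, rule ccontr)
    fix s t assume *: "s \<in> R - {1}" "t \<in> R - {1}" "meet s s = meet t t" "s \<noteq> t"
    then have "{s, 1 / (s * s)} = {t, 1 / (t * t)}"
      using roots_meet[of s s] roots_meet[of t t] by auto
    \<comment> \<open>The simple root of each is the double root of the other, so \<open>s = 1 / t\<^sup>2 = s\<^sup>4\<close>, whence \<open>s\<^sup>3 = 1\<close>.\<close>
    with * have "s = 1 / (t * t)" "t = 1 / (s * s)" by (auto simp: doubleton_eq_iff)
    then have "s = s * s * (s * s)" by simp
    then have "s = 1 / (s * s)" using * R_nonzero[of s] by (simp add: field_simps)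
    with * cube_ne_1[of s] show False by simp
  qed
  then show ?thesis
    using finite_R card_R by (simp add: double_points_eq card_image R_def)
qed

text \<open>
  Each pair of lines meets in exactly one point, which is double or triple; a triple point
  accounts for three pairs and a double point for one.
\<close>
lemma pairs_of_lines_count:
  "3 * card (triple_points L) + card (double_points L) = n choose 2"
proof -
  define pairs where "pairs P = {A. A \<subseteq> roots_through n P \<and> card A = 2}" for P
  have fin: "finite (roots_through n P)" for P
    using finite_R roots_through_subset finite_subset by blast
  have card_pairs: "card (pairs P) = card (roots_through n P) choose 2" for P
    unfolding pairs_def using fin by (rule n_subsets)
  have finite_pairs: "finite (pairs P)" for P
    unfolding pairs_def using fin by simp
  have common: "P = Q" if "A \<in> pairs P" "A \<in> pairs Q" for A P Q
  proof -
    obtain a b where "A = {a, b}" "a \<noteq> b"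
      using \<open>A \<in> pairs P\<close> by (auto simp: pairs_def card_2_iff)
    then have "P = meet a b" "Q = meet a b"
      using that by (simp_all add: pairs_def eq_meet_R)
    then show ?thesis by simp
  qed
  have eq: "{A. A \<subseteq> R \<and> card A = 2} = (\<Union>P \<in> triple_points L \<union> double_points L. pairs P)"
  proof (intro equalityI subsetI)
    fix A assume "A \<in> {A. A \<subseteq> R \<and> card A = 2}"
    then obtain a b where ab: "A = {a, b}" "a \<noteq> b" "a \<in> R" "b \<in> R"
      by (auto simp: card_2_iff)
    have r: "roots_through n (meet a b) = {a, b, 1 / (a * b)}" using ab by (simp add: roots_meet)
    then have "card (roots_through n (meet a b)) \<in> {2, 3}"
      using ab(2) by (auto simp: card_insert_if)
    then have "meet a b \<in> triple_points L \<union> double_points L"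
      by (auto simp: points_of_multiplicity_roots meet_in_proj_points)
    moreover have "A \<in> pairs (meet a b)" using ab r by (auto simp: pairs_def)
    ultimately show "A \<in> (\<Union>P \<in> triple_points L \<union> double_points L. pairs P)" by blast
  qed (use roots_through_subset in \<open>auto simp: pairs_def\<close>)
  have finite_points: "finite (points_of_multiplicity k L)" if "k \<ge> 2" for k
  proof (rule finite_subset)
    show "points_of_multiplicity k L \<subseteq> (\<lambda>(a, b). meet a b) ` (R \<times> R)"
    proof
      fix P assume "P \<in> points_of_multiplicity k L"
      then have "card (roots_through n P) \<ge> 2"
        using that by (simp add: points_of_multiplicity_roots)
      then obtain A where "A \<in> pairs P" unfolding pairs_def
        by (metis (mono_tags, lifting) mem_Collect_eq obtain_subset_with_card_n)
      then obtain a b where "a \<in> roots_through n P" "b \<in> roots_through n P" "a \<noteq> b"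
        by (auto simp: pairs_def card_2_iff)
      then have "P = meet a b" "(a, b) \<in> R \<times> R"
        using roots_through_subset[of P] eq_meet_R[of a P b] by auto
      then show "P \<in> (\<lambda>(a, b). meet a b) ` (R \<times> R)" by force
    qed
  qed (simp add: finite_R)
  have disj_pairs: "pairs P \<inter> pairs Q = {}" if "P \<noteq> Q" for P Q
    using common that by blast
  have disj: "triple_points L \<inter> double_points L = {}"
    by (auto simp: points_of_multiplicity_def)
  have "n choose 2 = card (\<Union>P \<in> triple_points L \<union> double_points L. pairs P)"
    using n_subsets[OF finite_R, of 2] card_R eq by simp
  also have "\<dots> = (\<Sum>P \<in> triple_points L \<union> double_points L. card (pairs P))"
    using finite_points finite_pairs disj_pairs by (intro card_UN_disjoint) simp_all
  also have "\<dots> = (\<Sum>P \<in> triple_points L. card (pairs P)) + (\<Sum>P \<in> double_points L. card (pairs P))"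
    using finite_points disj by (intro sum.union_disjoint) auto
  also have "\<dots> = (\<Sum>P \<in> triple_points L. 3) + (\<Sum>P \<in> double_points L. 1)"
    by (intro arg_cong2[of _ _ _ _ "(+)"] sum.cong)
      (auto simp: card_pairs points_of_multiplicity_roots numeral_3_eq_3 choose_two)
  finally show ?thesis by simp
qed

lemma line_configuration_L: "line_configuration L" and card_L: "card L = n"
  using finite_R card_R inj_on_cubic_line_R R_nonzero cubic_line_in_proj_lines
  by (auto simp: line_configuration_def L_def card_image)

end

theorem theorem3p1:
  fixes p :: nat
  assumes "prime p" and "p \<ge> 3" and "p \<noteq> 3"
  shows "\<exists>L :: (complex ^ 3) set set set.
           line_configuration L \<and>
           card L = p\<^sup>2 \<and>
           real (card (triple_points L)) = ((real p)\<^sup>2 - 2) * ((real p)\<^sup>2 - 1) / 6 \<and>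
           card (double_points L) = p\<^sup>2 - 1"
proof -
  define n where "n = p\<^sup>2"
  define L where "L = cubic_line ` {t. t ^ n = 1}"
  have "coprime p 3"
    using assms by (intro primes_coprime) auto
  then have n: "n > 0" "coprime n 3"
    using assms by (auto simp: n_def)
  have D: "card (double_points L) = n - 1"
    unfolding L_def using n by (rule card_double_points)
  have "3 * card (triple_points L) + (n - 1) = n choose 2"
    using pairs_of_lines_count[OF n] D unfolding L_def by simp
  moreover have "real (n choose 2) = real n * (real n - 1) / 2"
    using n by (simp add: choose_two real_of_nat_div of_nat_diff)
  ultimately have "3 * real (card (triple_points L)) + (real n - 1) = real n * (real n - 1) / 2"
    using n by (metis of_nat_add of_nat_mult of_nat_numeral of_nat_diff of_nat_1 Suc_leI One_nat_def)
  then have "real (card (triple_points L)) = (real n - 2) * (real n - 1) / 6"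
    by (simp add: field_simps)
  with D line_configuration_L[OF n] card_L[OF n] show ?thesis
    unfolding L_def n_def by auto
qed

end
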